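(* Let $A$ be a finite group. Then there exists a finite group $G=H\rtimes A$, with $H$ a solvable group, such that $G$ possesses no characteristic conjugacy class of nontrivial cyclic subgroups; that is, there is no nontrivial cyclic subgroup $S\le G$ for which the conjugacy class $\{S^g : g\in G\}$ is mapped to itself by every automorphism of $G$.
   Context: $H\rtimes A$ is a semidirect product with normal subgroup $H$ and complement $A$. Notation: $S^g=g^{-1}Sg$. A conjugacy class of subgroups of $G$ is characteristic if it is invariant under $\mathrm{Aut}(G)$. *)

theory Defs
  imports "HOL-Algebra.Algebra"
begin

definition inner_semidirect_product ::
    "('g, 'm) monoid_scheme \<Rightarrow> 'g set \<Rightarrow> 'g set \<Rightarrow> bool"
  where "inner_semidirect_product G H K \<longleftrightarrow>
    H \<lhd> G \<and> subgroup K G \<and> H \<inter> K = {\<one>\<^bsub>G\<^esub>} \<and> H <#>\<^bsub>G\<^esub> K = carrier G"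

definition is_semidirect_product ::
    "('g, 'm) monoid_scheme \<Rightarrow> 'g set \<Rightarrow> ('a, 'n) monoid_scheme \<Rightarrow> bool"
  \<comment> \<open>\<open>G = H \<rtimes> A\<close>, where the group \<open>A\<close>, living on its own type, is identified with
      a complement of the normal subgroup \<open>H\<close> along an isomorphism.\<close>
  where "is_semidirect_product G H A \<longleftrightarrow>
    (\<exists>K. inner_semidirect_product G H K \<and> G\<lparr>carrier := K\<rparr> \<cong> A)"

definition conjugate_set ::
    "('g, 'm) monoid_scheme \<Rightarrow> 'g set \<Rightarrow> 'g \<Rightarrow> 'g set"
  \<comment> \<open>\<open>S\<^sup>g = g\<^sup>-\<^sup>1 S g\<close>\<close>
  where "conjugate_set G S g = ((inv\<^bsub>G\<^esub> g) <#\<^bsub>G\<^esub> S) #>\<^bsub>G\<^esub> g"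

definition subgroup_conj_class ::
    "('g, 'm) monoid_scheme \<Rightarrow> 'g set \<Rightarrow> 'g set set"
  where "subgroup_conj_class G S = {conjugate_set G S g | g. g \<in> carrier G}"

definition characteristic_class ::
    "('g, 'm) monoid_scheme \<Rightarrow> 'g set set \<Rightarrow> bool"
  \<comment> \<open>\<open>auto G\<close> is the carrier of the automorphism group \<open>AutoGroup G\<close>; it acts elementwise
      on sets of subsets of \<open>carrier G\<close>.\<close>
  where "characteristic_class G C \<longleftrightarrow> (\<forall>\<phi> \<in> auto G. (\<lambda>S. \<phi> ` S) ` C = C)"

end

theory Submission
  imports Defs "HOL-Library.Function_Algebras"
begin

text \<open>
  Let \<open>N = |A|\<close> and let \<open>\<mu>\<close> be the group of complex \<open>N\<close>-th roots of unity. Take for \<open>H\<close> the functions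
  \<open>f : A \<times> {0,\<dots>,n-1} \<rightarrow> \<mu>\<close> with \<open>\<Prod>\<^sub>t f(t,i) = 1\<close> for every \<open>i\<close>, on which \<open>A\<close> acts by translation,
  and \<open>G = H \<rtimes> A\<close>, where \<open>n = N\<^sup>3 + 1\<close>. Suppose all automorphisms map \<open>x \<in> G\<close> to conjugates of
  powers of \<open>x\<close>. There are at most \<open>N\<^sup>2\<close> powers and \<open>N\<close> possible \<open>A\<close>-components of the conjugating
  element, so among more than \<open>N\<^sup>3\<close> automorphisms two have \<open>H\<close>-conjugate values at \<open>x\<close>.

  If \<open>x \<in> H\<close>, then, \<open>H\<close> being abelian, two of the \<open>2\<^bsup>n-1\<^esup>\<close> transvections ``multiply \<open>f(_,j)\<close> by \<open>f(_,i)\<close>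
  for all \<open>j \<in> T\<close>'' agree at \<open>x\<close>, which forces \<open>f(_,i) = 1\<close>. If the \<open>A\<close>-component \<open>a\<close> of \<open>x\<close> is
  nontrivial, use conjugation by the functions \<open>e\<^sub>T\<close> with value a primitive root \<open>u\<close> at \<open>(1,j)\<close>,
  \<open>j \<in> T\<close>, and \<open>1\<close> elsewhere. Two \<open>H\<close>-conjugate values give an \<open>a\<close>-invariant function \<open>q\<close> with
  \<open>\<Prod>\<^sub>t q(t,i) = u\<^bsup>\<plusminus>1\<^esup>\<close>. But \<open>a\<close>-invariance makes this product a \<open>d\<close>-th power in \<open>\<mu>\<close> for some \<open>d > 1\<close>
  dividing \<open>N\<close>, and \<open>u\<^bsup>\<plusminus>1\<^esup>\<close> is not.
\<close>

section \<open>Copies of finite groups on \<open>nat\<close>, split homomorphisms,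
  solvability\<close>

text \<open>The construction below lives on pairs of a function and an element of \<open>A\<close>,
  while the theorem asks for a group on \<open>nat\<close>.\<close>

lemma (in group) nat_copy:
  assumes "finite (carrier G)"
  obtains G' :: "nat monoid" and h where "group G'" "h \<in> iso G G'"
proof -
  obtain f :: "'a \<Rightarrow> nat" where f: "inj_on f (carrier G)"
    using finite_imp_inj_to_nat_seg[OF assms] by blast
  define G' where "G' = \<lparr>carrier = f ` carrier G,
    monoid.mult = (\<lambda>x y. f (inv_into (carrier G) f x \<otimes> inv_into (carrier G) f y)), one = f \<one>\<rparr>"
  have iso: "f \<in> iso G G'"
    using f by (auto simp: G'_def iso_def hom_def bij_betw_def)
  \<comment> \<open>\<open>iso_imp_img_group\<close> yields a group whose unit is reset to the image
    of the unit, which here changes nothing.\<close>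
  moreover have "G'\<lparr>one := f \<one>\<rparr> = G'"
    by (simp add: G'_def)
  ultimately show thesis
    using that iso_imp_img_group[OF iso] by simp
qed

text \<open>Each \<open>x\<close> is the product of \<open>x \<otimes> inv s (h x)\<close>, which
  lies in the kernel, and \<open>s (h x)\<close>; since \<open>s\<close> is injective, its image is
  a complement isomorphic to \<open>H\<close>.\<close>

lemma (in group_hom) semidirect_product_section:
  assumes s: "s \<in> hom H G" and hs: "\<And>a. a \<in> carrier H \<Longrightarrow> h (s a) = a"
  shows "is_semidirect_product G (kernel G H h) H"
proof -
  interpret s: group_hom H G s
    using s by unfold_locales
  have inj: "inj_on s (carrier H)"
    using hs by (metis inj_on_inverseI)
  have "kernel G H h \<inter> s ` carrier H = {\<one>}"
    using hs by (auto simp: kernel_def image_iff intro!: bexI[of _ "\<one>\<^bsub>H\<^esub>"])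
  moreover have "kernel G H h <#> s ` carrier H = carrier G"
  proof (intro equalityI subsetI)
    fix x assume x: "x \<in> carrier G"
    then have "x \<otimes> inv s (h x) \<in> kernel G H h"
      using hs by (simp add: kernel_def)
    then have "(x \<otimes> inv s (h x)) \<otimes> s (h x) \<in> kernel G H h <#> s ` carrier H"
      using x unfolding set_mult_def
      by (intro UN_I[of "x \<otimes> inv s (h x)"] UN_I[of "s (h x)"]) simp_all
    then show "x \<in> kernel G H h <#> s ` carrier H"
      using x by (simp add: G.m_assoc)
  qed (auto simp: set_mult_def kernel_def)
  ultimately have "inner_semidirect_product G (kernel G H h) (s ` carrier H)"
    unfolding inner_semidirect_product_def
    using normal_kernel s.img_is_subgroup by blast
  moreover have "s \<in> iso H (G\<lparr>carrier := s ` carrier H\<rparr>)"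
    using inj by (auto simp: iso_def hom_def bij_betw_def)
  then have "G\<lparr>carrier := s ` carrier H\<rparr> \<cong> H"
    using H.iso_sym is_isoI by blast
  ultimately show ?thesis
    unfolding is_semidirect_product_def by blast
qed

lemma (in comm_group) solvable: "solvable G"
proof -
  have "derived G (carrier G) = {\<one>}"
    using derived_eq_singleton by simp
  then show ?thesis
    unfolding solvable_iff_trivial_derived_seq by (intro exI[of _ 1]) simp
qed

section \<open>Characteristic classes of cyclic subgroups\<close>

text \<open>Every automorphism sends \<open>x\<close> into a conjugate of the cyclic subgroup generated by \<open>x\<close>;
  in a finite group this says that the conjugacy class of that subgroup is characteristic.\<close>

definition cyclic_class_fixed :: "('g, 'm) monoid_scheme \<Rightarrow> 'g \<Rightarrow> bool" where
  "cyclic_class_fixed G x \<longleftrightarrow> (\<forall>\<phi> \<in> iso G G. \<exists>g \<in> carrier G. \<exists>k::int.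
     \<phi> x = inv\<^bsub>G\<^esub> g \<otimes>\<^bsub>G\<^esub> x [^]\<^bsub>G\<^esub> k \<otimes>\<^bsub>G\<^esub> g)"

lemma (in group) characteristic_imp_cyclic_class_fixed:
  assumes S: "subgroup S G" and gen: "x \<in> S" "S = range (\<lambda>k::int. x [^] k)"
    and char: "characteristic_class G (subgroup_conj_class G S)"
  shows "cyclic_class_fixed G x"
  unfolding cyclic_class_fixed_def
proof
  fix \<phi> assume \<phi>: "\<phi> \<in> iso G G"
  have SG: "S \<subseteq> carrier G" using S subgroup.subset by blast
  \<comment> \<open>Members of \<open>auto G\<close> are extensional, so \<open>\<phi>\<close> is
    cut down to the carrier.\<close>
  let ?\<phi> = "restrict \<phi> (carrier G)"
  have "?\<phi> \<in> auto G"
    using \<phi> by (auto simp: auto_def iso_def hom_def Bij_def)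
  then have eq: "(\<lambda>S. ?\<phi> ` S) ` subgroup_conj_class G S = subgroup_conj_class G S"
    using char unfolding characteristic_class_def by blast
  \<comment> \<open>Conjugating by the unit puts \<open>S\<close> into its own class, so the image
    of \<open>S\<close> is again a conjugate of \<open>S\<close>.\<close>
  have "conjugate_set G S \<one> = S"
    using SG by (auto simp: conjugate_set_def l_coset_def r_coset_def subset_iff)
  then have "S \<in> subgroup_conj_class G S"
    unfolding subgroup_conj_class_def by blast
  then have "?\<phi> ` S \<in> subgroup_conj_class G S"
    using eq by blast
  then obtain g where g: "g \<in> carrier G" "?\<phi> ` S = conjugate_set G S g"
    unfolding subgroup_conj_class_def by blast
  have "\<phi> x \<in> ?\<phi> ` S"
    using gen(1) SG by force
  then have "\<phi> x \<in> conjugate_set G S g"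
    unfolding g(2) .
  then obtain y where "y \<in> S" "\<phi> x = inv g \<otimes> y \<otimes> g"
    by (auto simp: conjugate_set_def l_coset_def r_coset_def)
  then show "\<exists>g\<in>carrier G. \<exists>k::int. \<phi> x = inv g \<otimes> x [^] k \<otimes> g"
    using g(1) gen(2) by blast
qed

lemma (in group) no_characteristic_cyclic_class:
  assumes "\<And>x. x \<in> carrier G \<Longrightarrow> cyclic_class_fixed G x \<Longrightarrow> x = \<one>"
  shows "\<not> (\<exists>S. subgroup S G \<and> cyclic_group (G\<lparr>carrier := S\<rparr>) \<and> S \<noteq> {\<one>} \<and>
         characteristic_class G (subgroup_conj_class G S))"
proof (intro notI, elim exE conjE)
  fix S assume S: "subgroup S G" "cyclic_group (G\<lparr>carrier := S\<rparr>)" "S \<noteq> {\<one>}"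
    and char: "characteristic_class G (subgroup_conj_class G S)"
  interpret S: group "G\<lparr>carrier := S\<rparr>"
    using S(1) by (rule subgroup_imp_group)
  obtain x where x: "x \<in> S" "S = range (\<lambda>k::int. x [^]\<^bsub>G\<lparr>carrier := S\<rparr>\<^esub> k)"
    using S(2) S.cyclic_group by auto
  then have gen: "S = range (\<lambda>k::int. x [^] k)"
    using int_pow_consistent[OF S(1) x(1)] by simp
  have "x = \<one>"
    using assms characteristic_imp_cyclic_class_fixed[OF S(1) x(1) gen char] x(1)
      subgroup.mem_carrier[OF S(1)] by blast
  then show False
    using gen S(3) by auto
qed

text \<open>An automorphism of \<open>G\<close> is carried to one of \<open>H\<close> by conjugating
  with \<open>h\<close>, and the conjugator found there pulls back. Thus the property passes from
  the copy on \<open>nat\<close> to the concrete group.\<close>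

lemma (in group_hom) cyclic_class_fixed_iso:
  assumes h: "h \<in> iso G H" and x: "x \<in> carrier G" and fixed: "cyclic_class_fixed H (h x)"
  shows "cyclic_class_fixed G x"
  unfolding cyclic_class_fixed_def
proof
  fix \<phi> assume \<phi>: "\<phi> \<in> iso G G"
  let ?h' = "inv_into (carrier G) h"
  have h': "?h' \<in> iso H G"
    using h G.iso_set_sym by blast
  have bij: "bij_betw h (carrier G) (carrier H)"
    using h by (simp add: iso_def)
  then have inv: "?h' (h y) = y" if "y \<in> carrier G" for y
    using that by (simp add: bij_betw_def)
  have "h \<circ> (\<phi> \<circ> ?h') \<in> iso H H"
    by (intro iso_set_trans[OF _ h] iso_set_trans[OF h' \<phi>])
  then obtain g k where g: "g \<in> carrier H"
    and eq: "h (\<phi> (?h' (h x))) = inv\<^bsub>H\<^esub> g \<otimes>\<^bsub>H\<^esub> h x [^]\<^bsub>H\<^esub> (k::int) \<otimes>\<^bsub>H\<^esub> g"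
    using bspec[OF fixed[unfolded cyclic_class_fixed_def]] unfolding o_apply by blast
  obtain g' where g': "g' \<in> carrier G" "g = h g'"
    using bij g unfolding bij_betw_def by blast
  have "h (\<phi> x) = h (inv g' \<otimes> x [^] k \<otimes> g')"
    using eq x g' inv by (simp add: hom_int_pow del: inv_into_f_f)
  moreover have "\<phi> x \<in> carrier G"
    using \<phi> x by (auto simp: iso_def hom_def)
  ultimately have "\<phi> x = inv g' \<otimes> x [^] k \<otimes> g'"
    using bij x g' by (intro inj_onD[of h "carrier G"]) (auto simp: bij_betw_def)
  then show "\<exists>g\<in>carrier G. \<exists>k::int. \<phi> x = inv g \<otimes> x [^] k \<otimes> g"
    using g' by blast
qed

text \<open>The residue of \<open>k i\<close> modulo \<open>M\<close> together with
  \<open>h (g i)\<close> takes at most \<open>M * order H\<close> values. Two indices sharing this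
  pair conjugate the same power of \<open>x\<close>, by elements that differ by a member of the
  kernel.\<close>

lemma (in group_hom) conjugates_pigeonhole:
  assumes x: "x \<in> carrier G" "x [^] M = \<one>" and M: "(M::nat) > 0"
    and fin: "finite (carrier H)" and I: "card I > M * order H"
    and y: "\<And>i. i \<in> I \<Longrightarrow> \<exists>g \<in> carrier G. \<exists>k::int. y i = inv g \<otimes> x [^] k \<otimes> g"
  shows "\<exists>i \<in> I. \<exists>j \<in> I. i \<noteq> j \<and> (\<exists>c \<in> kernel G H h. c \<otimes> y i = y j \<otimes> c)"
proof -
  obtain g k where gk: "\<And>i. i \<in> I \<Longrightarrow> g i \<in> carrier G"
    "\<And>i. i \<in> I \<Longrightarrow> y i = inv (g i) \<otimes> x [^] (k i :: int) \<otimes> g i"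
    using y by metis
  define F where "F i = (k i mod int M, h (g i))" for i
  have "F ` I \<subseteq> {0..<int M} \<times> carrier H"
    using gk(1) M by (auto simp: F_def)
  moreover have "card ({0..<int M} \<times> carrier H) = M * order H"
    by (simp add: order_def card_cartesian_product)
  ultimately have "card (F ` I) < card I"
    using I fin by (metis card_mono finite_SigmaI finite_atLeastLessThan_int le_less_trans)
  then have "\<not> inj_on F I"
    using pigeonhole by blast
  then obtain i j where ij: "i \<in> I" "j \<in> I" "i \<noteq> j" "F i = F j"
    unfolding inj_on_def by blast
  have pow: "x [^] l = x [^] (l mod int M)" for l :: int
  proof -
    have "x [^] (int M * (l div int M)) = (x [^] int M) [^] (l div int M)"
      using x by (simp add: G.int_pow_pow)
    also have "\<dots> = \<one>"
      using x by (simp add: int_pow_int)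
    finally have one: "x [^] (int M * (l div int M)) = \<one>" .
    have "x [^] l = x [^] (int M * (l div int M) + l mod int M)"
      by simp
    also have "\<dots> = x [^] (l mod int M)"
      using x one by (subst G.int_pow_mult) simp_all
    finally show ?thesis .
  qed
  define z where "z = x [^] k i"
  have z: "z \<in> carrier G" "y i = inv (g i) \<otimes> z \<otimes> g i" "y j = inv (g j) \<otimes> z \<otimes> g j"
    using x gk(2) ij pow[of "k i"] pow[of "k j"] by (auto simp: z_def F_def)
  \<comment> \<open>Both \<open>c \<otimes> y i\<close> and \<open>y j \<otimes> c\<close> equal
    \<open>inv (g j) \<otimes> z \<otimes> g i\<close>.\<close>
  define c where "c = inv (g j) \<otimes> g i"
  have "c \<in> kernel G H h"
    using gk(1) ij by (simp add: c_def kernel_def F_def)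
  moreover have "c \<otimes> y i = y j \<otimes> c"
  proof -
    have cancel: "a \<otimes> (inv a \<otimes> b) = b" if "a \<in> carrier G" "b \<in> carrier G" for a b
      using that by (simp flip: G.m_assoc)
    show ?thesis
      using gk(1) ij z by (simp add: c_def G.m_assoc cancel)
  qed
  ultimately show ?thesis
    using ij by blast
qed

lemma (in group) iso_self_if_finite:
  assumes "finite (carrier G)" "\<phi> \<in> hom G G" "inj_on \<phi> (carrier G)"
  shows "\<phi> \<in> iso G G"
proof -
  have "\<phi> ` carrier G = carrier G"
    using assms by (intro endo_inj_surj) (auto simp: hom_def)
  then show ?thesis
    using assms by (simp add: iso_def bij_betw_def)
qed

section \<open>Products of translation-invariant functions, roots of unity\<close>

text \<open>\<open>q\<close> is constant on right cosets of \<open>K\<close>, so the coset of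
  \<open>s\<close> contributes \<open>q s ^ card K\<close>; raising to the index turns the exponent
  into \<open>order G\<close> by Lagrange.\<close>

lemma (in group) prod_left_invariant_pow:
  fixes q :: "'a \<Rightarrow> 'c::comm_semiring_1"
  assumes fin: "finite (carrier G)" and K: "subgroup K G"
    and q: "\<And>x t. x \<in> K \<Longrightarrow> t \<in> carrier G \<Longrightarrow> q (x \<otimes> t) = q t"
    and root: "\<And>t. t \<in> carrier G \<Longrightarrow> q t ^ order G = 1"
  shows "(\<Prod>t\<in>carrier G. q t) ^ card (rcosets K) = 1"
proof -
  have finC: "finite C" "card C = card K" if "C \<in> rcosets K" for C
    using that fin K by (auto simp: card_rcosets_equal subgroup.subset intro: rev_finite_subset[OF fin] dest: rcosets_part_G)
  have "(\<Prod>t\<in>carrier G. q t) = (\<Prod>t\<in>\<Union>(rcosets K). q t)"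
    using rcosets_part_G[OF K] by simp
  also have "\<dots> = (\<Prod>C\<in>rcosets K. \<Prod>t\<in>C. q t)"
    using rcos_disjoint[OF K] finC by (intro prod.Union_disjoint[unfolded o_def]) (auto simp: pairwise_def disjnt_def)
  finally have "(\<Prod>t\<in>carrier G. q t) ^ card (rcosets K) = (\<Prod>C\<in>rcosets K. (\<Prod>t\<in>C. q t) ^ card (rcosets K))"
    by (simp add: prod_power_distrib)
  also have "\<dots> = 1"
  proof (rule prod.neutral, rule ballI)
    fix C assume C: "C \<in> rcosets K"
    then obtain s where s: "s \<in> carrier G" "C = K #> s"
      by (auto simp: RCOSETS_def)
    have "(\<Prod>t\<in>C. q t) = (\<Prod>t\<in>C. q s)"
      using s q by (intro prod.cong) (auto simp: r_coset_def)
    then have "(\<Prod>t\<in>C. q t) ^ card (rcosets K) = q s ^ (card (rcosets K) * card K)"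
      using finC[OF C] by (simp add: power_mult mult.commute flip: power_mult)
    then show "(\<Prod>t\<in>C. q t) ^ card (rcosets K) = 1"
      using lagrange[OF K] root[OF s(1)] by simp
  qed
  finally show ?thesis .
qed

text \<open>The stabiliser of \<open>q\<close> under left translation contains \<open>a\<close>
  besides the unit, so its index is smaller than \<open>order G\<close> and serves as
  \<open>r\<close>.\<close>

lemma (in group) prod_left_invariant_proper_order:
  fixes q :: "'a \<Rightarrow> 'c::comm_semiring_1"
  assumes fin: "finite (carrier G)" and a: "a \<in> carrier G" "a \<noteq> \<one>"
    and q: "\<And>t. t \<in> carrier G \<Longrightarrow> q (a \<otimes> t) = q t"
    and root: "\<And>t. t \<in> carrier G \<Longrightarrow> q t ^ order G = 1"
  shows "\<exists>r. 0 < r \<and> r < order G \<and> (\<Prod>t\<in>carrier G. q t) ^ r = 1"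
proof -
  define K where "K = {x \<in> carrier G. \<forall>t\<in>carrier G. q (x \<otimes> t) = q t}"
  have K: "subgroup K G"
  proof (rule subgroupI)
    show "inv x \<in> K" if "x \<in> K" for x
    proof -
      have "q (inv x \<otimes> t) = q t" if t: "t \<in> carrier G" for t
      proof -
        have "q (x \<otimes> (inv x \<otimes> t)) = q (inv x \<otimes> t)"
          using \<open>x \<in> K\<close> t by (simp add: K_def)
        then show ?thesis
          using \<open>x \<in> K\<close> t by (simp add: K_def flip: m_assoc)
      qed
      then show ?thesis
        using \<open>x \<in> K\<close> by (simp add: K_def)
    qed
  qed (auto simp: K_def m_assoc intro!: exI[of _ \<one>])
  have finK: "finite K"
    using fin by (simp add: K_def)
  have "{\<one>, a} \<subseteq> K"
    using a q by (auto simp: K_def)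
  then have "card {\<one>, a} \<le> card K"
    using finK by (rule card_mono[rotated])
  then have "card K > 1"
    using a by simp
  moreover have l: "card (rcosets K) * card K = order G"
    using lagrange[OF K] .
  moreover have "order G > 0"
    using fin order_gt_0_iff_finite by blast
  ultimately have "0 < card (rcosets K)" "card (rcosets K) < order G"
    by (auto simp flip: l intro: gr0I)
  moreover have "(\<Prod>t\<in>carrier G. q t) ^ card (rcosets K) = 1"
    by (rule prod_left_invariant_pow[OF fin K]) (use root in \<open>auto simp: K_def\<close>)
  ultimately show ?thesis
    by blast
qed

lemma primitive_root_of_unity:
  assumes "n > 0"
  obtains u :: complex where "u ^ n = 1" "\<And>r. 0 < r \<Longrightarrow> r < n \<Longrightarrow> u ^ r \<noteq> 1"
proof
  let ?c = "\<lambda>k. cis (2 * pi * real k / real n)"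
  have pow: "?c 1 ^ k = ?c k" for k
    by (simp add: DeMoivre mult_ac)
  show "?c 1 ^ n = 1"
    unfolding pow using assms by simp
  show "?c 1 ^ r \<noteq> 1" if "0 < r" "r < n" for r
  proof
    assume "?c 1 ^ r = 1"
    then have "?c r = ?c 0"
      unfolding pow by simp
    moreover have "inj_on ?c {..<n}"
      using bij_betw_roots_unity[OF assms] by (rule bij_betw_imp_inj_on)
    ultimately have "r = 0"
      using assms that by (intro inj_onD[of ?c "{..<n}"]) auto
    then show False
      using that by simp
  qed
qed

section \<open>The group \<open>G\<close> and its exponent\<close>

locale wreath = group A for A (structure) +
  fixes n :: nat
  assumes finite_carrier: "finite (carrier A)"
begin

text \<open>The default value 1 off the index set makes equality of total functions agree with
  equality on that set, and pointwise products preserve it.\<close>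

definition base :: "('a \<Rightarrow> nat \<Rightarrow> complex) set" where
  "base = {f. (\<forall>t i. f t i ^ order A = 1) \<and> (\<forall>t i. t \<notin> carrier A \<or> n \<le> i \<longrightarrow> f t i = 1)}"

text \<open>The inverse makes this a left action of \<open>A\<close>.\<close>

definition shift :: "'a \<Rightarrow> ('a \<Rightarrow> nat \<Rightarrow> complex) \<Rightarrow> 'a \<Rightarrow> nat \<Rightarrow> complex" where
  "shift a f t = (if t \<in> carrier A then f (inv a \<otimes> t) else 1)"

definition pinv :: "('a \<Rightarrow> nat \<Rightarrow> complex) \<Rightarrow> 'a \<Rightarrow> nat \<Rightarrow> complex" where
  "pinv f t i = inverse (f t i)"

definition aug :: "('a \<Rightarrow> nat \<Rightarrow> complex) \<Rightarrow> nat \<Rightarrow> complex" where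
  "aug f i = (\<Prod>t\<in>carrier A. f t i)"

text \<open>Functions in \<open>base\<close> with nontrivial product lie outside this subgroup, yet
  conjugation by them preserves \<open>G\<close>; these automorphisms deal with elements whose
  \<open>A\<close>-component is nontrivial.\<close>

definition aug_ker :: "('a \<Rightarrow> nat \<Rightarrow> complex) set" where
  "aug_ker = {f \<in> base. aug f = 1}"

definition G :: "(('a \<Rightarrow> nat \<Rightarrow> complex) \<times> 'a) monoid" where
  "G = \<lparr>carrier = aug_ker \<times> carrier A,
    monoid.mult = (\<lambda>x y. (fst x * shift (snd x) (fst y), snd x \<otimes> snd y)), one = (1, \<one>)\<rparr>"

lemma order_pos: "order A > 0"
  using finite_carrier order_gt_0_iff_finite by blast

lemma base_nonzero:
  assumes "f \<in> base"
  shows "f t i \<noteq> 0"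
proof -
  have "f t i ^ order A = 1"
    using assms by (simp add: base_def)
  then show ?thesis
    using order_pos by (auto simp: zero_power)
qed

lemma base_mult: "f \<in> base \<Longrightarrow> g \<in> base \<Longrightarrow> f * g \<in> base"
  by (auto simp: base_def power_mult_distrib)

lemma base_one: "1 \<in> base"
  by (auto simp: base_def)

lemma base_pinv: "f \<in> base \<Longrightarrow> pinv f \<in> base"
  by (auto simp: base_def pinv_def power_inverse)

lemma base_shift: "a \<in> carrier A \<Longrightarrow> f \<in> base \<Longrightarrow> shift a f \<in> base"
  by (auto simp: base_def shift_def)

lemma pinv_mult: "f \<in> base \<Longrightarrow> pinv f * f = 1" 
  by (auto simp: pinv_def base_nonzero fun_eq_iff)

lemma shift_mult: "shift a (f * g) = shift a f * shift a g"
  by (auto simp: shift_def fun_eq_iff)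

lemma shift_1: "shift a 1 = 1"
  by (auto simp: shift_def fun_eq_iff)

lemma shift_shift: "a \<in> carrier A \<Longrightarrow> b \<in> carrier A \<Longrightarrow> shift a (shift b f) = shift (a \<otimes> b) f"
  by (auto simp: shift_def fun_eq_iff inv_mult_group m_assoc)

lemma shift_one: "f \<in> base \<Longrightarrow> shift \<one> f = f"
  by (auto simp: shift_def base_def fun_eq_iff)

lemma aug_mult: "aug (f * g) = aug f * aug g"
  by (auto simp: aug_def prod.distrib)

lemma aug_1: "aug 1 = 1"
  by (auto simp: aug_def)

lemma aug_shift:
  assumes "a \<in> carrier A"
  shows "aug (shift a f) = aug f"
proof
  fix i
  show "aug (shift a f) i = aug f i"
    unfolding aug_def
    by (rule prod.reindex_bij_witness[of _ "\<lambda>t. a \<otimes> t" "\<lambda>t. inv a \<otimes> t"])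
      (use assms in \<open>simp_all add: shift_def flip: m_assoc\<close>)
qed

lemma aug_pinv: "f \<in> base \<Longrightarrow> aug f * aug (pinv f) = 1"
  by (metis aug_1 aug_mult mult.commute pinv_mult)

lemma aug_ker_mult: "f \<in> aug_ker \<Longrightarrow> g \<in> aug_ker \<Longrightarrow> f * g \<in> aug_ker"
  by (simp add: aug_ker_def base_mult aug_mult)

lemma aug_ker_shift: "a \<in> carrier A \<Longrightarrow> f \<in> aug_ker \<Longrightarrow> shift a f \<in> aug_ker"
  by (simp add: aug_ker_def base_shift aug_shift)

lemma aug_ker_one: "1 \<in> aug_ker"
  by (simp add: aug_ker_def base_one aug_1)

lemma aug_ker_pinv: "f \<in> aug_ker \<Longrightarrow> pinv f \<in> aug_ker"
  using aug_pinv[of f] by (simp add: aug_ker_def base_pinv)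

lemma aug_ker_base: "f \<in> aug_ker \<Longrightarrow> f \<in> base"
  by (simp add: aug_ker_def)

lemma finite_base: "finite base"
proof -
  \<comment> \<open>Finiteness is obtained one argument at a time: first for the rows
    \<open>f t\<close>, then for functions into such rows.\<close>
  let ?R = "{z::complex. z ^ order A = 1}"
  let ?F = "{g. \<forall>i. (i \<in> {..<n} \<longrightarrow> g i \<in> ?R) \<and> (i \<notin> {..<n} \<longrightarrow> g i = 1)}"
  have "finite ?F"
    using order_pos by (intro finite_set_of_finite_funs finite_nth_roots) auto
  then have "finite {f. \<forall>t. (t \<in> carrier A \<longrightarrow> f t \<in> ?F) \<and> (t \<notin> carrier A \<longrightarrow> f t = 1)}"
    by (rule finite_set_of_finite_funs[OF finite_carrier])
  then show ?thesis
    by (rule rev_finite_subset) (auto simp: base_def fun_eq_iff)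
qed

lemma finite_G: "finite (carrier G)"
  using finite_base finite_carrier by (auto simp: G_def aug_ker_def)

lemma G_mult: "(f, a) \<otimes>\<^bsub>G\<^esub> (g, b) = (f * shift a g, a \<otimes> b)"
  by (simp add: G_def)

lemma G_carrier: "carrier G = aug_ker \<times> carrier A"
  by (simp add: G_def)

lemma G_one: "\<one>\<^bsub>G\<^esub> = (1, \<one>)"
  by (simp add: G_def)

lemma group_G: "group G"
proof (rule groupI)
  fix x assume "x \<in> carrier G"
  then obtain f a where x: "x = (f, a)" "f \<in> aug_ker" "a \<in> carrier A"
    by (auto simp: G_carrier)
  have "shift (inv a) (pinv f) * shift (inv a) f = 1"
    using x aug_ker_base by (simp add: pinv_mult shift_1 flip: shift_mult)
  then have "(shift (inv a) (pinv f), inv a) \<otimes>\<^bsub>G\<^esub> x = \<one>\<^bsub>G\<^esub>"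
    using x by (simp add: G_mult G_one)
  moreover have "(shift (inv a) (pinv f), inv a) \<in> carrier G"
    using x by (simp add: G_carrier aug_ker_shift aug_ker_pinv)
  ultimately show "\<exists>y\<in>carrier G. y \<otimes>\<^bsub>G\<^esub> x = \<one>\<^bsub>G\<^esub>"
    by blast
qed (auto simp: G_carrier G_mult G_one aug_ker_mult aug_ker_shift aug_ker_one m_assoc
    shift_mult shift_shift shift_one aug_ker_base mult.assoc)

lemma group_hom_snd: "group_hom G A snd"
  using group_G by (auto simp: group_hom_def group_hom_axioms_def hom_def G_carrier G_mult)

lemma section_hom: "(\<lambda>a. (1, a)) \<in> hom A G"
  by (auto simp: hom_def G_carrier G_mult aug_ker_one shift_1)

lemma kernel_snd: "kernel G A snd = aug_ker \<times> {\<one>}"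
  by (auto simp: kernel_def G_carrier)

text \<open>The power \<open>order A\<close> kills the \<open>A\<close>-component; what remains is a
  function with values in the roots of unity, and the same power kills it pointwise.\<close>

lemma G_pow_exponent:
  assumes x: "x \<in> carrier G"
  shows "x [^]\<^bsub>G\<^esub> (order A * order A) = \<one>\<^bsub>G\<^esub>"
proof -
  interpret G: group G by (rule group_G)
  interpret group_hom G A snd by (rule group_hom_snd)
  have "snd (x [^]\<^bsub>G\<^esub> order A) = \<one>"
    using x by (simp add: hom_nat_pow pow_order_eq_1 finite_carrier)
  moreover have "x [^]\<^bsub>G\<^esub> order A \<in> carrier G"
    using x by simp
  ultimately obtain f where f: "f \<in> aug_ker" "x [^]\<^bsub>G\<^esub> order A = (f, \<one>)"
    by (auto simp: G_carrier)
  have "(f, \<one>) [^]\<^bsub>G\<^esub> k = (f ^ k, \<one>)" for k :: nat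
    by (induction k) (use f in \<open>simp_all add: G_one G_mult shift_one aug_ker_base mult.commute fun_eq_iff\<close>)
  moreover have "(f ^ k) t i = f t i ^ k" for k t i
    by (induction k) simp_all
  then have "f ^ order A = 1"
    using aug_ker_base[OF f(1)] by (auto simp: base_def fun_eq_iff)
  ultimately have "(x [^]\<^bsub>G\<^esub> order A) [^]\<^bsub>G\<^esub> order A = \<one>\<^bsub>G\<^esub>"
    using f by (simp add: G_one)
  then show ?thesis
    using x by (simp add: G.nat_pow_pow)
qed

section \<open>Two families of automorphisms of \<open>G\<close>\<close>

text \<open>Conjugation by the element \<open>e\<close> of the full base group, which normalises \<open>G\<close>.\<close>

definition outer_conj :: "('a \<Rightarrow> nat \<Rightarrow> complex) \<Rightarrow> ('a \<Rightarrow> nat \<Rightarrow> complex) \<times> 'a \<Rightarrow> ('a \<Rightarrow> nat \<Rightarrow> complex) \<times> 'a"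
  where "outer_conj e = (\<lambda>(f, a). (e * f * shift a (pinv e), a))"

text \<open>\<open>aug\<close> is invariant under \<open>shift\<close>, so the contributions of
  \<open>e\<close> and \<open>shift a (pinv e)\<close> cancel and the image stays in
  \<open>aug_ker\<close> even when \<open>e\<close> is not in it.\<close>

lemma outer_conj_iso:
  assumes e: "e \<in> base"
  shows "outer_conj e \<in> iso G G"
proof (rule group.iso_self_if_finite[OF group_G finite_G])
  have inv: "shift a (pinv e) * shift a e = 1" for a
    using e by (simp add: pinv_mult shift_1 flip: shift_mult)
  show "outer_conj e \<in> hom G G"
  proof (rule homI)
    fix x assume "x \<in> carrier G"
    then show "outer_conj e x \<in> carrier G"
      using e aug_pinv[OF e] by (auto simp: outer_conj_def G_carrier aug_ker_def aug_mult aug_shift base_mult base_shift base_pinv)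
  next
    fix x y assume "x \<in> carrier G" "y \<in> carrier G"
    then obtain f a g b where xy: "x = (f, a)" "y = (g, b)" "a \<in> carrier A" "b \<in> carrier A"
      by (auto simp: G_carrier)
    have "e * f * shift a (pinv e) * (shift a e * shift a g * shift (a \<otimes> b) (pinv e))
      = (shift a (pinv e) * shift a e) * (e * (f * shift a g) * shift (a \<otimes> b) (pinv e))"
      by (simp only: mult_ac)
    then show "outer_conj e (x \<otimes>\<^bsub>G\<^esub> y) = outer_conj e x \<otimes>\<^bsub>G\<^esub> outer_conj e y"
      using xy by (simp add: outer_conj_def G_mult shift_mult shift_shift inv)
  qed
  show "inj_on (outer_conj e) (carrier G)"
  proof (rule inj_on_inverseI)
    fix x assume "x \<in> carrier G"
    obtain f a where x: "x = (f, a)" by (cases x)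
    have "pinv e * (e * f * shift a (pinv e)) * shift a e = (pinv e * e) * (shift a (pinv e) * shift a e) * f"
      by (simp only: mult_ac)
    then show "(\<lambda>(f, a). (pinv e * f * shift a e, a)) (outer_conj e x) = x"
      using e by (simp add: x outer_conj_def inv pinv_mult)
  qed
qed

definition transvect :: "nat \<Rightarrow> nat set \<Rightarrow> ('a \<Rightarrow> nat \<Rightarrow> complex) \<Rightarrow> 'a \<Rightarrow> nat \<Rightarrow> complex" where
  "transvect i T f t j = (if j \<in> T then f t j * f t i else f t j)"

text \<open>The map acts on the second index only, hence commutes with \<open>shift\<close>. As
  \<open>i \<notin> T\<close>, column \<open>i\<close> is unchanged and can be divided out of the
  others, which gives injectivity.\<close>

lemma transvect_iso:
  assumes T: "T \<subseteq> {..<n} - {i}"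
  shows "map_prod (transvect i T) id \<in> iso G G"
proof (rule group.iso_self_if_finite[OF group_G finite_G])
  have "transvect i T f \<in> aug_ker" if f: "f \<in> aug_ker" for f
  proof -
    have "transvect i T f \<in> base"
      using f T by (auto simp: aug_ker_def base_def transvect_def power_mult_distrib)
    moreover have "aug (transvect i T f) j = (if j \<in> T then aug f j * aug f i else aug f j)" for j
      by (simp add: aug_def transvect_def prod.distrib)
    ultimately show ?thesis
      using f by (auto simp: aug_ker_def fun_eq_iff)
  qed
  moreover have "transvect i T (f * g) = transvect i T f * transvect i T g" for f g
    by (auto simp: transvect_def fun_eq_iff)
  moreover have "transvect i T (shift a f) = shift a (transvect i T f)" for a f
    by (auto simp: transvect_def shift_def fun_eq_iff)
  ultimately show "map_prod (transvect i T) id \<in> hom G G"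
    by (auto simp: hom_def G_carrier G_mult)
  have "f = g" if "f \<in> base" and eq: "transvect i T f = transvect i T g" for f g
  proof (intro ext)
    fix t j
    have "i \<notin> T"
      using T by blast
    have tv: "transvect i T f t k = transvect i T g t k" for k
      using eq by simp
    have "f t i = g t i"
      using tv[of i] \<open>i \<notin> T\<close> by (simp add: transvect_def)
    then show "f t j = g t j"
      using tv[of j] base_nonzero[OF \<open>f \<in> base\<close>, of t i] by (auto simp: transvect_def split: if_splits)
  qed
  then show "inj_on (map_prod (transvect i T) id) (carrier G)"
    by (auto simp: inj_on_def G_carrier aug_ker_def)
qed

section \<open>Elements whose cyclic class is preserved\<close>

text \<open>The pigeonhole needs more than \<open>order A ^ 3\<close> indices, and the subsets of
  \<open>J\<close> supply at least \<open>2 ^ (order A ^ 3)\<close>.\<close>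

lemma cyclic_class_fixed_imp_kernel_conjugate:
  assumes x: "x \<in> carrier G" and fixed: "cyclic_class_fixed G x"
    and J: "finite J" "card J \<ge> order A ^ 3"
    and \<phi>: "\<And>T. T \<subseteq> J \<Longrightarrow> \<phi> T \<in> iso G G"
  obtains T T' c where "T \<subseteq> J" "T' \<subseteq> J" "T \<noteq> T'" "c \<in> aug_ker"
    "(c, \<one>) \<otimes>\<^bsub>G\<^esub> \<phi> T x = \<phi> T' x \<otimes>\<^bsub>G\<^esub> (c, \<one>)"
proof -
  interpret group_hom G A snd by (rule group_hom_snd)
  have "order A * order A * order A = order A ^ 3"
    by (simp add: power3_eq_cube)
  also have "\<dots> < 2 ^ (order A ^ 3)"
    by (rule less_exp)
  also have "\<dots> \<le> card (Pow J)"
    using J by (simp add: card_Pow)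
  finally have "\<exists>T\<in>Pow J. \<exists>T'\<in>Pow J. T \<noteq> T' \<and>
    (\<exists>c\<in>kernel G A snd. c \<otimes>\<^bsub>G\<^esub> \<phi> T x = \<phi> T' x \<otimes>\<^bsub>G\<^esub> c)"
    using x G_pow_exponent[OF x] order_pos finite_carrier fixed \<phi>
    by (intro conjugates_pigeonhole[where M = "order A * order A" and x = x])
      (auto simp: cyclic_class_fixed_def)
  then show thesis
    using that by (auto simp: kernel_snd)
qed

lemma cyclic_class_fixed_imp_one:
  assumes n: "n = Suc (order A ^ 3)" and x: "x \<in> carrier G" and fixed: "cyclic_class_fixed G x"
  shows "x = \<one>\<^bsub>G\<^esub>"
proof -
  obtain f a where fa: "x = (f, a)" "f \<in> aug_ker" "a \<in> carrier A"
    using x by (auto simp: G_carrier)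
  have a: "a = \<one>"
  proof (rule ccontr)
    assume "a \<noteq> \<one>"
    \<comment> \<open>The contradiction will be a positive exponent below \<open>order A\<close>
      that kills \<open>u\<close>.\<close>
    obtain u :: complex where u: "u ^ order A = 1" "\<And>r. 0 < r \<Longrightarrow> r < order A \<Longrightarrow> u ^ r \<noteq> 1"
      using primitive_root_of_unity[OF order_pos] by blast
    define e where "e T t i = (if t = \<one> \<and> i \<in> T then u else 1)" for T :: "nat set" and t i
    have e: "e T \<in> base" if "T \<subseteq> {..<n}" for T
      using that u by (auto simp: e_def base_def)
    have aug_e: "aug (e T) i = (if i \<in> T then u else 1)" for T i
      using finite_carrier by (simp add: aug_def e_def)
    obtain T T' c where T: "T \<subseteq> {..<n}" "T' \<subseteq> {..<n}" "T \<noteq> T'" and c: "c \<in> aug_ker"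
      and eq: "(c, \<one>) \<otimes>\<^bsub>G\<^esub> outer_conj (e T) x = outer_conj (e T') x \<otimes>\<^bsub>G\<^esub> (c, \<one>)"
      by (rule cyclic_class_fixed_imp_kernel_conjugate[OF x fixed, of "{..<n}" "\<lambda>T. outer_conj (e T)"])
        (use n e outer_conj_iso in auto)
    \<comment> \<open>In the extension of the full base group by \<open>A\<close>, \<open>eq\<close>
      says that \<open>q\<close> centralises \<open>x\<close>; since functions commute,
      \<open>f\<close> drops out of this relation.\<close>
    define q where "q = c * e T * pinv (e T')"
    have bases: "f \<in> base" "c \<in> base" "e T \<in> base" "e T' \<in> base"
      using fa c T e by (auto intro: aug_ker_base)
    then have q_base: "q \<in> base"
      by (simp add: q_def base_mult base_pinv)
    text \<open>Comparing the two conjugates of \<open>x\<close> says that \<open>q\<close> is fixed by \<open>a\<close>.\<close>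
    have "shift \<one> (e T * f * shift a (pinv (e T))) = e T * f * shift a (pinv (e T))"
      using fa bases by (intro shift_one base_mult base_shift base_pinv)
    then have eq': "c * (e T * f * shift a (pinv (e T))) = e T' * f * shift a (pinv (e T')) * shift a c"
      using eq fa by (simp add: outer_conj_def G_mult)
    have "shift a q = q"
    proof -
      have "q = (pinv f * f) * (shift a (pinv (e T)) * shift a (e T)) * q"
        using bases by (simp add: pinv_mult shift_1 flip: shift_mult)
      also have "\<dots> = pinv f * pinv (e T') * shift a (e T) * (c * (e T * f * shift a (pinv (e T))))"
        unfolding q_def by (simp only: mult_ac)
      also have "\<dots> = (pinv f * f) * (pinv (e T') * e T') * shift a q"
        unfolding eq' unfolding q_def shift_mult by (simp only: mult_ac)
      finally show ?thesis
        using bases by (simp add: pinv_mult)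
    qed
    then have q: "q (inv a \<otimes> t) = q t" if "t \<in> carrier A" for t
      using that by (metis shift_def)
    \<comment> \<open>\<open>shift a\<close> translates by \<open>inv a\<close>, which is nontrivial
      along with \<open>a\<close>.\<close>
    have main: "\<exists>r. 0 < r \<and> r < order A \<and> aug q i ^ r = 1" for i
      unfolding aug_def
      using finite_carrier fa \<open>a \<noteq> \<one>\<close> q q_base
      by (intro prod_left_invariant_proper_order[of "inv a"]) (auto simp: base_def)
    \<comment> \<open>At such an index one of \<open>e T\<close>, \<open>e T'\<close> has product
      \<open>u\<close> and the other 1; as \<open>aug c = 1\<close>, this makes
      \<open>aug q i\<close> equal to \<open>u\<close> or its inverse.\<close>
    obtain i where i: "i \<in> T \<longleftrightarrow> i \<notin> T'"
      using T by blast
    have "aug (e T') i * aug q i = aug (e T) i"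
    proof -
      have "e T' * q = (pinv (e T') * e T') * (c * e T)"
        unfolding q_def by (simp only: mult_ac)
      then have "aug (e T' * q) = aug (c * e T)"
        using bases by (simp add: pinv_mult)
      then show ?thesis
        using c by (simp add: aug_mult aug_ker_def fun_eq_iff)
    qed
    then have "aug q i = u \<or> u * aug q i = 1"
      using i by (auto simp: aug_e split: if_splits)
    moreover obtain r where r: "0 < r" "r < order A" "aug q i ^ r = 1"
      using main by blast
    ultimately have "u ^ r = 1"
      by (metis mult.right_neutral power_mult_distrib power_one)
    then show False
      using u(2) r by blast
  qed
  have "f = 1"
  proof (rule ccontr)
    assume "f \<noteq> 1"
    then obtain t i where ti: "f t i \<noteq> 1"
      by (auto simp: fun_eq_iff)
    then have i: "i < n"
      using fa aug_ker_base by (force simp: base_def not_less)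
    \<comment> \<open>The successor in \<open>n\<close> pays for removing \<open>i\<close>: exactly
      \<open>order A ^ 3\<close> indices remain.\<close>
    let ?J = "{..<n} - {i}"
    obtain T T' c where T: "T \<subseteq> ?J" "T' \<subseteq> ?J" "T \<noteq> T'" and c: "c \<in> aug_ker"
      and eq: "(c, \<one>) \<otimes>\<^bsub>G\<^esub> map_prod (transvect i T) id x = map_prod (transvect i T') id x \<otimes>\<^bsub>G\<^esub> (c, \<one>)"
      by (rule cyclic_class_fixed_imp_kernel_conjugate[OF x fixed, of ?J "\<lambda>T. map_prod (transvect i T) id"])
        (use n i transvect_iso in auto)
    have "map_prod (transvect i T) id x \<in> carrier G"
      using transvect_iso[OF T(1)] x by (auto simp: iso_def hom_def)
    then have "transvect i T f \<in> base"
      using fa by (simp add: G_carrier aug_ker_base)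
    \<comment> \<open>With trivial \<open>A\<close>-component the shifts disappear, so
      \<open>c\<close> commutes past the other factor and can be cancelled.\<close>
    then have eq': "c * transvect i T f = c * transvect i T' f"
      using eq fa a c by (simp add: G_mult shift_one aug_ker_base mult.commute)
    have tv: "transvect i T f t j = transvect i T' f t j" for j
      using fun_cong[OF fun_cong[OF eq', of t], of j] base_nonzero[of c t j] c aug_ker_base by simp
    \<comment> \<open>Only one of the two transvections multiplies column \<open>j\<close> by column
      \<open>i\<close>, so their agreement forces \<open>f t i = 1\<close>.\<close>
    obtain j where "j \<in> T \<longleftrightarrow> j \<notin> T'"
      using T by blast
    then have "f t j * f t i = f t j"
      using tv[of j] by (auto simp: transvect_def split: if_splits)
    then show False
      using ti base_nonzero[of f t j] fa aug_ker_base by simp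
  qed
  then show ?thesis
    using fa a by (simp add: G_one)
qed

end

section \<open>Transport of the construction to \<open>nat\<close>\<close>

theorem theorem2:
  fixes A :: "('a, 'b) monoid_scheme"
  assumes "group A" and "finite (carrier A)"
  shows "\<exists>(G :: nat monoid) H.
    group G \<and> finite (carrier G) \<and>
    is_semidirect_product G H A \<and>
    solvable (G\<lparr>carrier := H\<rparr>) \<and>
    \<not> (\<exists>S. subgroup S G \<and> cyclic_group (G\<lparr>carrier := S\<rparr>) \<and> S \<noteq> {\<one>\<^bsub>G\<^esub>} \<and>
         characteristic_class G (subgroup_conj_class G S))"
proof -
  interpret A: group A by fact
  interpret wreath A "Suc (order A ^ 3)"
    using assms by unfold_locales
  interpret G: group G by (rule group_G)
  obtain G' :: "nat monoid" and h where G': "group G'" and h: "h \<in> iso G G'"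
    using G.nat_copy[OF finite_G] by blast
  interpret G': group G' by fact
  interpret h: group_hom G G' h
    using h by unfold_locales (simp add: iso_def)
  let ?h' = "inv_into (carrier G) h"
  have h': "?h' \<in> iso G' G"
    using h G.iso_set_sym by blast
  have inj: "inj_on h (carrier G)" and surj: "h ` carrier G = carrier G'"
    using h by (auto simp: iso_def bij_betw_def)
  interpret snd: group_hom G A snd by (rule group_hom_snd)
  \<comment> \<open>The normal subgroup of the copy is the kernel of this projection, that is, the
    image under \<open>h\<close> of the abelian kernel in \<open>G\<close>.\<close>
  interpret p: group_hom G' A "snd \<circ> ?h'"
    using h' snd.homh by unfold_locales (auto simp: iso_def intro: hom_compose)
  have "is_semidirect_product G' (kernel G' A (snd \<circ> ?h')) A"
  proof (rule p.semidirect_product_section)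
    show "h \<circ> (\<lambda>a. (1, a)) \<in> hom A G'"
      using section_hom h.homh by (rule hom_compose)
    show "(snd \<circ> ?h') ((h \<circ> (\<lambda>a. (1, a))) a) = a" if "a \<in> carrier A" for a
      using that inj by (simp add: G_carrier aug_ker_one)
  qed
  moreover have "solvable (G'\<lparr>carrier := kernel G' A (snd \<circ> ?h')\<rparr>)"
  proof -
    interpret K: group "G'\<lparr>carrier := kernel G' A (snd \<circ> ?h')\<rparr>"
      using p.subgroup_kernel by (rule G'.subgroup_imp_group)
    have ker: "kernel G' A (snd \<circ> ?h') = h ` (aug_ker \<times> {\<one>\<^bsub>A\<^esub>})"
    proof (intro equalityI subsetI)
      fix x assume x: "x \<in> kernel G' A (snd \<circ> ?h')"
      then have "x = h (?h' x)" "?h' x \<in> carrier G"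
        using surj by (auto simp: kernel_def f_inv_into_f inv_into_into)
      moreover have "snd (?h' x) = \<one>\<^bsub>A\<^esub>"
        using x by (simp add: kernel_def)
      ultimately show "x \<in> h ` (aug_ker \<times> {\<one>\<^bsub>A\<^esub>})"
        unfolding kernel_snd[symmetric] kernel_def by blast
    qed (use inj in \<open>auto simp: kernel_def G_carrier\<close>)
    have comm: "x \<otimes>\<^bsub>G\<^esub> y = y \<otimes>\<^bsub>G\<^esub> x" if "x \<in> aug_ker \<times> {\<one>\<^bsub>A\<^esub>}" "y \<in> aug_ker \<times> {\<one>\<^bsub>A\<^esub>}" for x y
      using that by (auto simp: G_mult shift_one aug_ker_base mult.commute)
    have "comm_group (G'\<lparr>carrier := kernel G' A (snd \<circ> ?h')\<rparr>)"
    proof (rule K.group_comm_groupI, simp add: ker, safe)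
      fix f g assume "f \<in> aug_ker" "g \<in> aug_ker"
      then show "h (f, \<one>\<^bsub>A\<^esub>) \<otimes>\<^bsub>G'\<^esub> h (g, \<one>\<^bsub>A\<^esub>) = h (g, \<one>\<^bsub>A\<^esub>) \<otimes>\<^bsub>G'\<^esub> h (f, \<one>\<^bsub>A\<^esub>)"
        using comm by (simp add: G_carrier flip: h.hom_mult)
    qed
    then show ?thesis
      by (rule comm_group.solvable)
  qed
  moreover have "y = \<one>\<^bsub>G'\<^esub>" if "y \<in> carrier G'" "cyclic_class_fixed G' y" for y
  proof -
    have "y \<in> h ` carrier G"
      using that(1) surj by simp
    then obtain x where x: "x \<in> carrier G" "y = h x"
      by blast
    then have "x = \<one>\<^bsub>G\<^esub>"
      using that(2) by (intro cyclic_class_fixed_imp_one h.cyclic_class_fixed_iso[OF h]) auto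
    then show ?thesis
      using x by simp
  qed
  note G'.no_characteristic_cyclic_class[OF this]
  moreover have "finite (carrier G')"
    using finite_G surj by (metis finite_imageI)
  ultimately show ?thesis
    using G' by blast
qed

end
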